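(* Let $(X,\|\cdot\|)$ be a (real) reflexive Banach space and equip $X$ with the partial order given by an ice cream cone $K_{f,\varepsilon}$. Then the topology induced by $\|\cdot\|$ is the order topology $\tau_o$ of the partially ordered vector space $(X,K_{f,\varepsilon})$, and it agrees with the order bound topology $\tau_{ob}$ of $(X,K_{f,\varepsilon})$.
   Context: Let $f$ be a linear functional on $X$ with $\|f\|:=\sup\{|f(x)|/\|x\|;\ x\in X\setminus\{0\}\}=1$ and let $\varepsilon\in(0,1)$. The ice cream cone with parameters $f$ and $\varepsilon$ is $K_{f,\varepsilon}:=\{x\in X;\ f(x)\geq\varepsilon\|x\|\}$. $(X,K_{f,\varepsilon})$ denotes $X$ with the partial order $x\leq y :\Leftrightarrow y-x\in K_{f,\varepsilon}$. Order intervals are the sets $[x,y]=\{z\in X;\ x\leq z\leq y\}$. For a net $(x_\alpha)_{\alpha\in A}$ in $X$ we write $x_\alpha\downarrow 0$ if the net is decreasing ($\alpha\leq\beta$ implies $x_\beta\leq x_\alpha$) and $\inf_{\alpha\in A} x_\alpha=0$. A set $M\subseteq X$ is net catching for $x\in X$ if for every net $(x_\alpha)_{\alpha\in A}$ in $X$ with $x_\alpha\downarrow 0$ there is $\alpha\in A$ with $[x-x_\alpha,x+x_\alpha]\subseteq M$. A set $O\subseteq X$ is order open if it is net catching for every $x\in O$. The order topology is $\tau_o=\{O\subseteq X;\ O\text{ order open}\}$. A set $M\subseteq X$ is circled if $\lambda M\subseteq M$ for all $\lambda\in[-1,1]$; $M$ absorbs $N\subseteq X$ if there is $\mu>0$ with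 $\lambda N\subseteq M$ for all $\lambda\in[-\mu,\mu]$. Let $\mathcal{B}_{ob}$ be the set of all convex, circled $V\subseteq X$ that absorb all order intervals. The order bound topology $\tau_{ob}$ is the vector space topology on $X$ for which $\mathcal{B}_{ob}$ is a base of neighbourhoods at $0$. *)

theory Defs
  imports "HOL-Analysis.Analysis"
begin

subsection \<open>Reflexive spaces\<close>

definition bidual_embedding ::
  "'a::real_normed_vector \<Rightarrow> (('a \<Rightarrow>\<^sub>L real) \<Rightarrow>\<^sub>L real)" where
  "bidual_embedding x = Blinfun (\<lambda>g. blinfun_apply g x)"

lemma bidual_embedding_apply [simp]:
  "blinfun_apply (bidual_embedding x) g = blinfun_apply g x"
  unfolding bidual_embedding_def
  by (simp add: bounded_linear_Blinfun_apply blinfun.bounded_linear_left)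

definition reflexive_space :: "'a::real_normed_vector itself \<Rightarrow> bool" where
  "reflexive_space _ \<longleftrightarrow> surj (bidual_embedding :: 'a \<Rightarrow> _)"


subsection \<open>The order given by a cone\<close>

definition ice_cream_cone :: "('a::real_normed_vector \<Rightarrow>\<^sub>L real) \<Rightarrow> real \<Rightarrow> 'a set" where
  "ice_cream_cone f \<epsilon> = {x. blinfun_apply f x \<ge> \<epsilon> * norm x}"

definition cone_le :: "'a::real_vector set \<Rightarrow> 'a \<Rightarrow> 'a \<Rightarrow> bool" where
  "cone_le K x y \<longleftrightarrow> y - x \<in> K"

definition order_interval :: "'a::real_vector set \<Rightarrow> 'a \<Rightarrow> 'a \<Rightarrow> 'a set" where
  "order_interval K x y = {z. cone_le K x z \<and> cone_le K z y}"

definition is_infimum :: "'a::real_vector set \<Rightarrow> 'a set \<Rightarrow> 'a \<Rightarrow> bool" where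
  "is_infimum K S m \<longleftrightarrow>
     (\<forall>s\<in>S. cone_le K m s) \<and> (\<forall>l. (\<forall>s\<in>S. cone_le K l s) \<longrightarrow> cone_le K l m)"

lemma ice_cream_cone_zero: "0 \<in> ice_cream_cone f \<epsilon>"
  by (simp add: ice_cream_cone_def)

lemma ice_cream_cone_add:
  assumes "0 \<le> \<epsilon>" "x \<in> ice_cream_cone f \<epsilon>" "y \<in> ice_cream_cone f \<epsilon>"
  shows "x + y \<in> ice_cream_cone f \<epsilon>"
proof -
  have "\<epsilon> * norm (x + y) \<le> \<epsilon> * (norm x + norm y)"
    using assms(1) by (intro mult_left_mono norm_triangle_ineq)
  then show ?thesis
    using assms(2,3) by (simp add: ice_cream_cone_def blinfun.add_right distrib_left)
qed

lemma ice_cream_cone_scaleR: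
  assumes "0 \<le> c" "x \<in> ice_cream_cone f \<epsilon>"
  shows "c *\<^sub>R x \<in> ice_cream_cone f \<epsilon>"
  using mult_left_mono[of "\<epsilon> * norm x" "blinfun_apply f x" c] assms
  by (simp add: ice_cream_cone_def blinfun.scaleR_right mult.left_commute)

lemma ice_cream_cone_pointed:
  assumes "0 < \<epsilon>" "x \<in> ice_cream_cone f \<epsilon>" "- x \<in> ice_cream_cone f \<epsilon>"
  shows "x = 0"
proof -
  have "\<epsilon> * norm x \<le> 0"
    using assms(2,3) by (simp add: ice_cream_cone_def blinfun.minus_right)
  then show ?thesis
    using assms(1) by (simp add: mult_le_0_iff)
qed


subsection \<open>Nets and the order topology\<close>

definition directed_set :: "'i set \<Rightarrow> ('i \<Rightarrow> 'i \<Rightarrow> bool) \<Rightarrow> bool" where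
  "directed_set A r \<longleftrightarrow>
     A \<noteq> {} \<and> reflp_on A r \<and> transp_on A r \<and> (\<forall>a\<in>A. \<forall>b\<in>A. \<exists>c\<in>A. r a c \<and> r b c)"

definition net_decreases_to_zero ::
  "'a::real_vector set \<Rightarrow> 'i set \<Rightarrow> ('i \<Rightarrow> 'i \<Rightarrow> bool) \<Rightarrow> ('i \<Rightarrow> 'a) \<Rightarrow> bool" where
  "net_decreases_to_zero K A r u \<longleftrightarrow>
     (\<forall>a\<in>A. \<forall>b\<in>A. r a b \<longrightarrow> cone_le K (u b) (u a)) \<and> is_infimum K (u ` A) 0"

text \<open>A definition cannot quantify over all index types.  The index sets below are the
  subsets of the space itself; lemma \<open>net_catching_any_index\<close> shows that nets over arbitrary
  index types are covered as well.\<close>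

definition net_catching :: "'a::real_vector set \<Rightarrow> 'a set \<Rightarrow> 'a \<Rightarrow> bool" where
  "net_catching K M x \<longleftrightarrow>
     (\<forall>(A :: 'a set) r u. directed_set A r \<and> net_decreases_to_zero K A r u \<longrightarrow>
        (\<exists>a\<in>A. order_interval K (x - u a) (x + u a) \<subseteq> M))"

definition order_open :: "'a::real_vector set \<Rightarrow> 'a set \<Rightarrow> bool" where
  "order_open K U \<longleftrightarrow> (\<forall>x\<in>U. net_catching K U x)"

definition order_topology :: "'a::real_vector set \<Rightarrow> 'a topology" where
  "order_topology K = topology (order_open K)"

lemma net_catching_any_index:
  fixes K :: "'a::real_vector set" and A :: "'i set"
  assumes K: "0 \<in> K" "\<And>x y. x \<in> K \<Longrightarrow> y \<in> K \<Longrightarrow> x + y \<in> K"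
    and M: "net_catching K M x"
    and dir: "directed_set A r" and dec: "net_decreases_to_zero K A r u"
  shows "\<exists>a\<in>A. order_interval K (x - u a) (x + u a) \<subseteq> M"
proof -
  define s where "s = (\<lambda>p q. cone_le K q p)"
  have "directed_set (u ` A) s"
    unfolding directed_set_def
  proof (intro conjI)
    show "u ` A \<noteq> {}" using dir by (auto simp: directed_set_def)
    show "reflp_on (u ` A) s" using K(1) by (auto simp: reflp_on_def s_def cone_le_def)
    show "transp_on (u ` A) s"
    proof (rule transp_onI)
      fix p q t assume "s p q" "s q t"
      then show "s p t" using K(2)[of "p - q" "q - t"] by (simp add: s_def cone_le_def)
    qed
    show "\<forall>a\<in>u ` A. \<forall>b\<in>u ` A. \<exists>c\<in>u ` A. s a c \<and> s b c"
      using dir dec unfolding directed_set_def net_decreases_to_zero_def s_def by blast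
  qed
  moreover have "net_decreases_to_zero K (u ` A) s id"
    using dec by (simp add: net_decreases_to_zero_def s_def)
  ultimately have "\<exists>a\<in>u ` A. order_interval K (x - id a) (x + id a) \<subseteq> M"
    using M unfolding net_catching_def by blast
  then show ?thesis by auto
qed

lemma istopology_order_open:
  fixes K :: "'a::real_vector set"
  assumes add: "\<And>x y. x \<in> K \<Longrightarrow> y \<in> K \<Longrightarrow> x + y \<in> K"
  shows "istopology (order_open K)"
  unfolding istopology_def
proof (intro conjI allI impI)
  fix S T :: "'a set" assume S: "order_open K S" and T: "order_open K T"
  show "order_open K (S \<inter> T)"
    unfolding order_open_def net_catching_def
  proof (intro ballI allI impI, elim conjE)
    fix x r and A :: "'a set" and u
    assume x: "x \<in> S \<inter> T" and d: "directed_set A r" and n: "net_decreases_to_zero K A r u"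
    obtain a b where ab: "a \<in> A" "b \<in> A"
      and a: "order_interval K (x - u a) (x + u a) \<subseteq> S"
      and b: "order_interval K (x - u b) (x + u b) \<subseteq> T"
      using S T x d n unfolding order_open_def net_catching_def by blast
    obtain c where c: "c \<in> A" "r a c" "r b c"
      using d ab unfolding directed_set_def by blast
    have sub: "order_interval K (x - u c) (x + u c) \<subseteq> order_interval K (x - u e) (x + u e)"
      if "e \<in> A" "r e c" for e
    proof
      fix z assume z: "z \<in> order_interval K (x - u c) (x + u c)"
      have e: "u e - u c \<in> K"
        using n that c(1) unfolding net_decreases_to_zero_def cone_le_def by blast
      show "z \<in> order_interval K (x - u e) (x + u e)"
        using add[OF _ e, of "z - (x - u c)"] add[OF _ e, of "x + u c - z"] z
        by (simp add: order_interval_def cone_le_def algebra_simps)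
    qed
    show "\<exists>a\<in>A. order_interval K (x - u a) (x + u a) \<subseteq> S \<inter> T"
      using sub[OF ab(1) c(2)] sub[OF ab(2) c(3)] a b c(1) by blast
  qed
next
  fix \<U> assume U: "\<forall>S\<in>\<U>. order_open K S"
  show "order_open K (\<Union>\<U>)"
    unfolding order_open_def net_catching_def
  proof (intro ballI allI impI)
    fix x r and A :: "'a set" and u
    assume "x \<in> \<Union>\<U>" and *: "directed_set A r \<and> net_decreases_to_zero K A r u"
    then obtain S where S: "x \<in> S" "S \<in> \<U>" by blast
    then obtain a where "a \<in> A" "order_interval K (x - u a) (x + u a) \<subseteq> S"
      using U * unfolding order_open_def net_catching_def by blast
    then show "\<exists>a\<in>A. order_interval K (x - u a) (x + u a) \<subseteq> \<Union>\<U>" using S by blast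
  qed
qed

lemma openin_order_topology_ice_cream_cone:
  assumes "0 \<le> \<epsilon>"
  shows "openin (order_topology (ice_cream_cone f \<epsilon>)) = order_open (ice_cream_cone f \<epsilon>)"
  unfolding order_topology_def
  by (intro topology_inverse' istopology_order_open ice_cream_cone_add assms)


subsection \<open>The order bound topology\<close>

definition circled :: "'a::real_vector set \<Rightarrow> bool" where
  "circled M \<longleftrightarrow> (\<forall>c\<in>{-1..1::real}. (*\<^sub>R) c ` M \<subseteq> M)"

definition absorbs :: "'a::real_vector set \<Rightarrow> 'a set \<Rightarrow> bool" where
  "absorbs M N \<longleftrightarrow> (\<exists>\<mu>>0. \<forall>c\<in>{-\<mu>..\<mu>::real}. (*\<^sub>R) c ` N \<subseteq> M)"

definition order_bound_base :: "'a::real_vector set \<Rightarrow> 'a set set" where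
  "order_bound_base K =
     {V. convex V \<and> circled V \<and> (\<forall>x y. absorbs V (order_interval K x y))}"

definition vector_topology :: "'a::real_vector topology \<Rightarrow> bool" where
  "vector_topology T \<longleftrightarrow>
     topspace T = UNIV \<and>
     continuous_map (prod_topology T T) T (\<lambda>(x, y). x + y) \<and>
     continuous_map (prod_topology euclideanreal T) T (\<lambda>(c, x). c *\<^sub>R x)"

text \<open>The library's \<open>neighbourhood_base_at\<close> does not require the sets of the base to be
  neighbourhoods, hence the first conjunct.\<close>

definition is_neighbourhood_base :: "'a topology \<Rightarrow> 'a \<Rightarrow> 'a set set \<Rightarrow> bool" where
  "is_neighbourhood_base T x \<B> \<longleftrightarrow>
     (\<forall>V\<in>\<B>. \<exists>U. openin T U \<and> x \<in> U \<and> U \<subseteq> V) \<and>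
     neighbourhood_base_at x (\<lambda>V. V \<in> \<B>) T"

definition order_bound_topology :: "'a::real_vector set \<Rightarrow> 'a topology" where
  "order_bound_topology K =
     (THE T. vector_topology T \<and> is_neighbourhood_base T 0 (order_bound_base K))"

lemma openin_vector_topology_iff:
  fixes T :: "'a::real_vector topology"
  assumes T: "vector_topology T" and B: "is_neighbourhood_base T 0 \<B>"
  shows "openin T U \<longleftrightarrow> (\<forall>x\<in>U. \<exists>V\<in>\<B>. (+) x ` V \<subseteq> U)"
proof -
  have top: "topspace T = UNIV" using T by (simp add: vector_topology_def)
  have trans: "openin T {y. x + y \<in> W}" if W: "openin T W" for x W
  proof -
    have "openin (prod_topology T T) {p. fst p + snd p \<in> W}"
      using T W unfolding vector_topology_def continuous_map_def
      by (auto simp: case_prod_beta' top)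
    then have *: "\<And>a b. a + b \<in> W \<Longrightarrow>
        \<exists>P Q. openin T P \<and> openin T Q \<and> a \<in> P \<and> b \<in> Q \<and> P \<times> Q \<subseteq> {p. fst p + snd p \<in> W}"
      unfolding openin_prod_topology_alt by simp
    show ?thesis
    proof (subst openin_subopen, intro ballI)
      fix y assume "y \<in> {y. x + y \<in> W}"
      then obtain P Q where "openin T Q" "x \<in> P" "y \<in> Q" "P \<times> Q \<subseteq> {p. fst p + snd p \<in> W}"
        using *[of x y] by blast
      then show "\<exists>Q. openin T Q \<and> y \<in> Q \<and> Q \<subseteq> {y. x + y \<in> W}"
        by (intro exI[of _ Q]) auto
    qed
  qed
  show ?thesis
  proof
    assume U: "openin T U"
    show "\<forall>x\<in>U. \<exists>V\<in>\<B>. (+) x ` V \<subseteq> U"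
    proof
      fix x assume "x \<in> U"
      then have "openin T {y. x + y \<in> U} \<and> 0 \<in> {y. x + y \<in> U}" using trans[OF U] by simp
      then obtain V where "V \<in> \<B>" "V \<subseteq> {y. x + y \<in> U}"
        using B unfolding is_neighbourhood_base_def neighbourhood_base_at_def by blast
      then show "\<exists>V\<in>\<B>. (+) x ` V \<subseteq> U" by blast
    qed
  next
    assume U: "\<forall>x\<in>U. \<exists>V\<in>\<B>. (+) x ` V \<subseteq> U"
    show "openin T U"
    proof (subst openin_subopen, intro ballI)
      fix x assume "x \<in> U"
      then obtain V where V: "V \<in> \<B>" "(+) x ` V \<subseteq> U" using U by blast
      then obtain W where W: "openin T W" "0 \<in> W" "W \<subseteq> V"
        using B unfolding is_neighbourhood_base_def by blast
      have "{y. - x + y \<in> W} \<subseteq> U"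
      proof
        fix y assume "y \<in> {y. - x + y \<in> W}"
        then have "x + (- x + y) \<in> U" using W(3) V(2) by blast
        then show "y \<in> U" by simp
      qed
      moreover have "openin T {y. - x + y \<in> W}" "x \<in> {y. - x + y \<in> W}"
        using trans[OF W(1), of "- x"] W(2) by simp_all
      ultimately show "\<exists>Q. openin T Q \<and> x \<in> Q \<and> Q \<subseteq> U" by blast
    qed
  qed
qed

lemma vector_topology_unique:
  assumes "vector_topology S" "is_neighbourhood_base S 0 \<B>"
    and "vector_topology T" "is_neighbourhood_base T 0 \<B>"
  shows "S = T"
  by (simp add: topology_eq openin_vector_topology_iff[OF assms(1,2)]
      openin_vector_topology_iff[OF assms(3,4)])

lemma order_bound_topology_eqI:
  assumes "vector_topology T" "is_neighbourhood_base T 0 (order_bound_base K)"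
  shows "order_bound_topology K = T"
  unfolding order_bound_topology_def
  using assms vector_topology_unique by (intro the_equality) blast+

lemma order_bound_base_Int:
  assumes "V \<in> order_bound_base K" "W \<in> order_bound_base K"
  shows "V \<inter> W \<in> order_bound_base K"
proof -
  have "absorbs (V \<inter> W) N" if VN: "absorbs V N" and WN: "absorbs W N" for N
  proof -
    obtain \<mu> \<nu> :: real where "\<mu> > 0" "\<nu> > 0"
      and "\<forall>c\<in>{-\<mu>..\<mu>}. (*\<^sub>R) c ` N \<subseteq> V" "\<forall>c\<in>{-\<nu>..\<nu>}. (*\<^sub>R) c ` N \<subseteq> W"
      using VN WN unfolding absorbs_def by blast
    then show ?thesis
      unfolding absorbs_def by (intro exI[of _ "min \<mu> \<nu>"]) fastforce
  qed
  moreover have "circled (V \<inter> W)"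
    using assms unfolding order_bound_base_def circled_def by blast
  ultimately show ?thesis
    using assms by (simp add: order_bound_base_def convex_Int)
qed

lemma order_bound_base_scaleR:
  assumes V: "V \<in> order_bound_base K" and c: "c > 0"
  shows "(*\<^sub>R) c ` V \<in> order_bound_base K"
proof -
  have "absorbs ((*\<^sub>R) c ` V) N" if N: "absorbs V N" for N
  proof -
    obtain \<mu> :: real where mu: "\<mu> > 0" "\<forall>d\<in>{-\<mu>..\<mu>}. (*\<^sub>R) d ` N \<subseteq> V"
      using N unfolding absorbs_def by blast
    have "d *\<^sub>R y \<in> (*\<^sub>R) c ` V" if "d \<in> {- (c * \<mu>)..c * \<mu>}" "y \<in> N" for d y
    proof -
      have "d / c \<in> {-\<mu>..\<mu>}" using that(1) c by (auto simp: field_simps)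
      then have "(d / c) *\<^sub>R y \<in> V" using mu(2) that(2) by blast
      then have "c *\<^sub>R ((d / c) *\<^sub>R y) \<in> (*\<^sub>R) c ` V" by blast
      then show ?thesis using c by simp
    qed
    then show ?thesis
      unfolding absorbs_def using mu(1) c by (intro exI[of _ "c * \<mu>"]) auto
  qed
  moreover have "circled ((*\<^sub>R) c ` V)"
    unfolding circled_def
  proof (intro ballI subsetI)
    fix d :: real and y assume d: "d \<in> {-1..1}" and "y \<in> (*\<^sub>R) d ` (*\<^sub>R) c ` V"
    then obtain v where v: "v \<in> V" "y = d *\<^sub>R c *\<^sub>R v" by blast
    then have "d *\<^sub>R v \<in> V"
      using V d unfolding order_bound_base_def circled_def by blast
    moreover have "y = c *\<^sub>R d *\<^sub>R v" using v by (simp add: mult.commute)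
    ultimately show "y \<in> (*\<^sub>R) c ` V" by blast
  qed
  ultimately show ?thesis
    using V by (simp add: order_bound_base_def convex_scaling)
qed

lemma order_bound_topology_exists:
  fixes K :: "'a::real_vector set"
  assumes K: "0 \<in> K"
  shows "\<exists>T. vector_topology T \<and> is_neighbourhood_base T 0 (order_bound_base K)"
proof -
  let ?B = "order_bound_base K"
  define P where "P = (\<lambda>U. \<forall>x\<in>U. \<exists>V\<in>?B. (+) x ` V \<subseteq> U)"
  define T where "T = topology P"
  have "istopology P"
    unfolding istopology_def
  proof (intro conjI allI impI)
    fix S U assume S: "P S" and U: "P U"
    show "P (S \<inter> U)"
      unfolding P_def
    proof
      fix x assume "x \<in> S \<inter> U"
      then obtain V W where "V \<in> ?B" "W \<in> ?B" "(+) x ` V \<subseteq> S" "(+) x ` W \<subseteq> U"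
        using S U unfolding P_def by blast
      then show "\<exists>V\<in>?B. (+) x ` V \<subseteq> S \<inter> U"
        by (intro bexI[of _ "V \<inter> W"] order_bound_base_Int) auto
    qed
  next
    fix \<U> assume "\<forall>S\<in>\<U>. P S"
    then show "P (\<Union>\<U>)" unfolding P_def by (meson Union_iff Union_upper order_trans)
  qed
  then have op: "openin T U \<longleftrightarrow> P U" for U by (simp add: T_def)
  have "UNIV \<in> ?B"
    by (auto simp: order_bound_base_def circled_def absorbs_def intro: exI[of _ 1])
  then have "openin T UNIV" unfolding op P_def by blast
  then have top: "topspace T = UNIV" using openin_subset by blast
  have zero: "0 \<in> V" and point: "\<exists>\<mu>>0. \<forall>d\<in>{-\<mu>..\<mu>::real}. d *\<^sub>R y \<in> V" if "V \<in> ?B" for V y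
  proof -
    have "absorbs V (order_interval K y y)" for y using that by (simp add: order_bound_base_def)
    moreover have "y \<in> order_interval K y y" for y
      using K by (simp add: order_interval_def cone_le_def)
    ultimately have *: "\<exists>\<mu>>0. \<forall>d\<in>{-\<mu>..\<mu>::real}. d *\<^sub>R y \<in> V" for y
      unfolding absorbs_def by blast
    show "\<exists>\<mu>>0. \<forall>d\<in>{-\<mu>..\<mu>::real}. d *\<^sub>R y \<in> V" by (rule *)
    from *[of 0] show "0 \<in> V" by force
  qed
  have half: "\<exists>W\<in>?B. \<forall>v\<in>W. \<forall>w\<in>W. v + w \<in> V" if V: "V \<in> ?B" for V
  proof (intro bexI ballI)
    show "(*\<^sub>R) (1/2) ` V \<in> ?B" using order_bound_base_scaleR[OF V, of "1/2"] by simp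
    fix v w assume "v \<in> (*\<^sub>R) (1/2) ` V" "w \<in> (*\<^sub>R) (1/2) ` V"
    then show "v + w \<in> V"
      using V convexD[of V _ _ "1/2" "1/2"] by (auto simp: order_bound_base_def)
  qed
  have nbhd: "\<exists>U. openin T U \<and> x \<in> U \<and> U \<subseteq> (+) x ` V" if V: "V \<in> ?B" for V x
  proof (intro exI conjI)
    let ?U = "{y. \<exists>W\<in>?B. (+) y ` W \<subseteq> (+) x ` V}"
    show "x \<in> ?U" using V by blast
    show "?U \<subseteq> (+) x ` V"
    proof
      fix y assume "y \<in> ?U"
      then obtain W where W: "W \<in> ?B" "(+) y ` W \<subseteq> (+) x ` V" by blast
      then have "y + 0 \<in> (+) x ` V" using zero[OF W(1)] by blast
      then show "y \<in> (+) x ` V" by simp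
    qed
    show "openin T ?U"
      unfolding op P_def
    proof
      fix y assume "y \<in> ?U"
      then obtain W where W: "W \<in> ?B" "(+) y ` W \<subseteq> (+) x ` V" by blast
      obtain H where H: "H \<in> ?B" "\<forall>v\<in>H. \<forall>w\<in>H. v + w \<in> W" using half[OF W(1)] by blast
      have "y + h \<in> ?U" if h: "h \<in> H" for h
      proof -
        have "(y + h) + g \<in> (+) x ` V" if "g \<in> H" for g
          using H(2) h that W(2) by (auto simp: add.assoc)
        then show ?thesis using H(1) by blast
      qed
      then show "\<exists>V\<in>?B. (+) y ` V \<subseteq> ?U" using H(1) by blast
    qed
  qed
  have base: "is_neighbourhood_base T 0 ?B"
    unfolding is_neighbourhood_base_def neighbourhood_base_at_def
  proof (intro conjI ballI allI impI)
    fix V assume "V \<in> ?B"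
    then show "\<exists>U. openin T U \<and> 0 \<in> U \<and> U \<subseteq> V" using nbhd[of V 0] by simp
  next
    fix S assume "openin T S \<and> 0 \<in> S"
    then obtain V where "V \<in> ?B" "(+) 0 ` V \<subseteq> S" unfolding op P_def by blast
    then show "\<exists>U V. openin T U \<and> V \<in> ?B \<and> 0 \<in> U \<and> U \<subseteq> V \<and> V \<subseteq> S"
      using nbhd[of V 0] by auto
  qed
  have add: "continuous_map (prod_topology T T) T (\<lambda>(x, y). x + y)"
    unfolding continuous_map_def
  proof (intro conjI allI impI)
    fix S assume S: "openin T S"
    have "openin (prod_topology T T) {p. case p of (x, y) \<Rightarrow> x + y \<in> S}"
      unfolding openin_prod_topology_alt
    proof (intro allI impI)
      fix x y assume "(x, y) \<in> {p. case p of (x, y) \<Rightarrow> x + y \<in> S}"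
      then obtain V where V: "V \<in> ?B" "(+) (x + y) ` V \<subseteq> S"
        using S unfolding op P_def by blast
      obtain H where H: "H \<in> ?B" "\<forall>v\<in>H. \<forall>w\<in>H. v + w \<in> V" using half[OF V(1)] by blast
      obtain A where A: "openin T A" "x \<in> A" "A \<subseteq> (+) x ` H" using nbhd[OF H(1)] by blast
      obtain B where B: "openin T B" "y \<in> B" "B \<subseteq> (+) y ` H" using nbhd[OF H(1)] by blast
      have "a + b \<in> S" if a: "a \<in> A" and b: "b \<in> B" for a b
      proof -
        obtain g where g: "g \<in> H" "a = x + g" using a A(3) by blast
        obtain h where h: "h \<in> H" "b = y + h" using b B(3) by blast
        have "g + h \<in> V" using H(2) g(1) h(1) by blast
        then have "(x + y) + (g + h) \<in> S" using V(2) by blast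
        then show ?thesis using g h by (simp add: algebra_simps)
      qed
      then have "A \<times> B \<subseteq> {p. case p of (x, y) \<Rightarrow> x + y \<in> S}" by auto
      then show "\<exists>U V. openin T U \<and> openin T V \<and> x \<in> U \<and> y \<in> V \<and>
          U \<times> V \<subseteq> {p. case p of (x, y) \<Rightarrow> x + y \<in> S}"
        using A B by blast
    qed
    then show "openin (prod_topology T T)
        {p \<in> topspace (prod_topology T T). (case p of (x, y) \<Rightarrow> x + y) \<in> S}"
      by (simp add: top case_prod_beta')
  qed (simp add: top)
  have scale: "continuous_map (prod_topology euclideanreal T) T (\<lambda>(c, x). c *\<^sub>R x)"
    unfolding continuous_map_def
  proof (intro conjI allI impI)
    fix S assume S: "openin T S"
    have "openin (prod_topology euclideanreal T) {p. case p of (c, x) \<Rightarrow> c *\<^sub>R x \<in> S}"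
      unfolding openin_prod_topology_alt
    proof (intro allI impI)
      fix c :: real and x assume "(c, x) \<in> {p. case p of (c, x) \<Rightarrow> c *\<^sub>R x \<in> S}"
      then obtain V where V: "V \<in> ?B" "(+) (c *\<^sub>R x) ` V \<subseteq> S"
        using S unfolding op P_def by blast
      obtain H where H: "H \<in> ?B" "\<forall>v\<in>H. \<forall>w\<in>H. v + w \<in> V" using half[OF V(1)] by blast
      obtain \<mu> :: real where mu: "\<mu> > 0" "\<forall>d\<in>{-\<mu>..\<mu>}. d *\<^sub>R x \<in> H" using point[OF H(1)] by blast
      define m where "m = \<bar>c\<bar> + 1"
      have m: "m > 0" by (simp add: m_def add_nonneg_pos)
      obtain A where A: "openin T A" "x \<in> A" "A \<subseteq> (+) x ` (*\<^sub>R) (1/m) ` H"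
        using nbhd[OF order_bound_base_scaleR[OF H(1), of "1/m"]] m by auto
      define R where "R = {c - min \<mu> 1<..<c + min \<mu> 1}"
      have "r *\<^sub>R a \<in> S" if r: "r \<in> R" and a: "a \<in> A" for r a
      proof -
        obtain h where h: "h \<in> H" "a = x + (1/m) *\<^sub>R h" using a A(3) by blast
        have "r - c \<in> {-\<mu>..\<mu>}" using r by (auto simp: R_def)
        then have 1: "(r - c) *\<^sub>R x \<in> H" using mu(2) by blast
        have "\<bar>r\<bar> \<le> m" using r by (auto simp: R_def m_def)
        then have "r / m \<in> {-1..1}" using m by (auto simp: field_simps abs_le_iff)
        then have "(r / m) *\<^sub>R h \<in> H"
          using H(1) h(1) unfolding order_bound_base_def circled_def by blast
        then have "(r - c) *\<^sub>R x + (r / m) *\<^sub>R h \<in> V" using 1 H(2) by blast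
        then have "c *\<^sub>R x + ((r - c) *\<^sub>R x + (r / m) *\<^sub>R h) \<in> S" using V(2) by blast
        then show ?thesis using h by (simp add: algebra_simps)
      qed
      then have "R \<times> A \<subseteq> {p. case p of (c, x) \<Rightarrow> c *\<^sub>R x \<in> S}" by auto
      moreover have "openin euclideanreal R" "c \<in> R" using mu(1) by (auto simp: R_def)
      ultimately show "\<exists>U V. openin euclideanreal U \<and> openin T V \<and> c \<in> U \<and> x \<in> V \<and>
          U \<times> V \<subseteq> {p. case p of (c, x) \<Rightarrow> c *\<^sub>R x \<in> S}"
        using A by blast
    qed
    then show "openin (prod_topology euclideanreal T)
        {p \<in> topspace (prod_topology euclideanreal T). (case p of (c, x) \<Rightarrow> c *\<^sub>R x) \<in> S}"
      by (simp add: top case_prod_beta')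
  qed (simp add: top)
  show ?thesis using top add scale base unfolding vector_topology_def by blast
qed

lemma order_bound_topology_characterization:
  fixes K :: "'a::real_vector set"
  assumes "0 \<in> K"
  shows "vector_topology (order_bound_topology K)"
    and "is_neighbourhood_base (order_bound_topology K) 0 (order_bound_base K)"
proof -
  obtain T where "vector_topology T" "is_neighbourhood_base T 0 (order_bound_base K)"
    using order_bound_topology_exists[OF assms] by blast
  then show "vector_topology (order_bound_topology K)"
    and "is_neighbourhood_base (order_bound_topology K) 0 (order_bound_base K)"
    using order_bound_topology_eqI[of T K] by simp_all
qed

end

theory Submission
  imports Defs
begin

text \<open>Let \<open>K\<close> be the cone. Since \<open>\<epsilon> < 1 = \<parallel>f\<parallel>\<close>, there is \<open>e\<close> with \<open>f e > \<epsilon> \<parallel>e\<parallel>\<close>, an interior point of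
  \<open>K\<close>, so the intervals \<open>[-t e, t e]\<close> are norm neighbourhoods of \<open>0\<close>; conversely \<open>\<epsilon> \<parallel>x\<parallel> \<le> f x\<close> on \<open>K\<close>
  makes every order interval norm bounded. Hence the order bound topology is the norm topology.
  As \<open>e/n \<down> 0\<close>, order open sets are norm open. For the converse, if \<open>u\<^sub>\<alpha> \<down> 0\<close> then \<open>f u\<^sub>\<alpha>\<close> is a
  decreasing net of nonnegative reals, and \<open>\<epsilon> \<parallel>u\<^sub>\<alpha> - u\<^sub>\<beta>\<parallel> \<le> f u\<^sub>\<alpha> - f u\<^sub>\<beta>\<close> for \<open>\<alpha> \<le> \<beta>\<close> makes \<open>u\<close> norm
  Cauchy; its limit is a lower bound of \<open>u\<close>, so it is \<open>0\<close>.\<close>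

section \<open>Geometry of the cone and its order intervals\<close>

lemma closed_ice_cream_cone: "closed (ice_cream_cone f \<epsilon>)"
  unfolding ice_cream_cone_def by (intro closed_Collect_le continuous_intros)

text \<open>Otherwise the bound at \<open>x\<close> and \<open>- x\<close> would give |f x| \<le>
  \<epsilon> * norm x everywhere, hence \<open>norm f\<close> \<le> \<epsilon>.\<close>

lemma exists_blinfun_gt:
  fixes f :: "'a::real_normed_vector \<Rightarrow>\<^sub>L real"
  assumes "0 \<le> \<epsilon>" "\<epsilon> < norm f"
  obtains e where "\<epsilon> * norm e < blinfun_apply f e"
proof (cases "\<forall>x. blinfun_apply f x \<le> \<epsilon> * norm x")
  case True
  have "norm (blinfun_apply f x) \<le> \<epsilon> * norm x" for x
    using True[rule_format, of x] True[rule_format, of "- x"]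
    by (simp add: blinfun.minus_right abs_le_iff)
  then have "norm f \<le> \<epsilon>" using assms(1) by (intro norm_blinfun_bound)
  then show ?thesis using assms(2) by simp
next
  case False
  then show ?thesis using that by (meson not_le)
qed

text \<open>Adding \<open>w\<close> to \<open>t *\<^sub>R e\<close> lowers \<open>f\<close> by at
  most \<open>norm w\<close> and raises \<epsilon> times the norm by at most \<open>norm w\<close>.
  The cone inequality has slack \<open>t\<close> times the gap at \<open>e\<close>, which covers
  both losses; hence the factor 2.\<close>

lemma ice_cream_interval_contains_ball:
  fixes f :: "'a::real_normed_vector \<Rightarrow>\<^sub>L real"
  assumes f: "norm f = 1" and \<epsilon>: "0 < \<epsilon>" "\<epsilon> < 1" and t: "0 \<le> t"
    and z: "2 * norm (z - x) \<le> t * (blinfun_apply f e - \<epsilon> * norm e)"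
  shows "z \<in> order_interval (ice_cream_cone f \<epsilon>) (x - t *\<^sub>R e) (x + t *\<^sub>R e)"
proof -
  have mem: "t *\<^sub>R e + w \<in> ice_cream_cone f \<epsilon>" if "norm w = norm (z - x)" for w
  proof -
    have "\<bar>blinfun_apply f w\<bar> \<le> norm w" using norm_blinfun[of f w] f by simp
    moreover have "\<epsilon> * norm (t *\<^sub>R e + w) \<le> \<epsilon> * (t * norm e + norm w)"
      using \<epsilon> t norm_triangle_ineq[of "t *\<^sub>R e" w] by (intro mult_left_mono) auto
    moreover have "\<epsilon> * norm w \<le> norm w" using \<epsilon> by (simp add: mult_left_le_one_le)
    ultimately show ?thesis
      using z that
      by (simp add: ice_cream_cone_def blinfun.add_right blinfun.scaleR_right algebra_simps)
  qed
  show ?thesis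
    using mem[of "z - x"] mem[of "x - z"]
    by (simp add: order_interval_def cone_le_def algebra_simps norm_minus_commute)
qed

text \<open>Since \<open>f\<close> is nonnegative on the cone, f (z - x) \<le> f (y - x). The bound
  is uniform in \<open>z\<close>, so order intervals are norm bounded.\<close>

lemma norm_diff_le_of_order_interval:
  assumes "0 < \<epsilon>" "z \<in> order_interval (ice_cream_cone f \<epsilon>) x y"
  shows "\<epsilon> * norm (z - x) \<le> blinfun_apply f (y - x)"
proof -
  have "\<epsilon> * norm (z - x) \<le> blinfun_apply f (z - x)" "0 \<le> blinfun_apply f (y - z)"
    using assms order_trans[of 0 "\<epsilon> * norm (y - z)"]
    by (auto simp: order_interval_def cone_le_def ice_cream_cone_def)
  then show ?thesis by (simp add: blinfun.diff_right)
qed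

text \<open>Both \<open>v + (z - x)\<close> and \<open>v - (z - x)\<close> lie in the cone. Adding
  the two cone inequalities cancels \<open>f (z - x)\<close>, while the difference of the two
  vectors is \<open>2 *\<^sub>R (z - x)\<close>.\<close>

lemma norm_diff_center_le_of_order_interval:
  assumes \<epsilon>: "0 < \<epsilon>" and z: "z \<in> order_interval (ice_cream_cone f \<epsilon>) (x - v) (x + v)"
  shows "\<epsilon> * norm (z - x) \<le> blinfun_apply f v"
proof -
  have "\<epsilon> * norm (v + (z - x)) \<le> blinfun_apply f (v + (z - x))"
    "\<epsilon> * norm (v - (z - x)) \<le> blinfun_apply f (v - (z - x))"
    using z by (simp_all add: order_interval_def cone_le_def ice_cream_cone_def algebra_simps)
  then have "\<epsilon> * (norm (v + (z - x)) + norm (v - (z - x))) \<le> 2 * blinfun_apply f v"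
    unfolding distrib_left blinfun.add_right blinfun.diff_right[of f v] by linarith
  moreover have "norm (2 *\<^sub>R (z - x)) \<le> norm (v + (z - x)) + norm (v - (z - x))"
    using norm_triangle_ineq4[of "v + (z - x)" "v - (z - x)"] by (simp add: scaleR_2 algebra_simps)
  then have "\<epsilon> * (2 * norm (z - x)) \<le> \<epsilon> * (norm (v + (z - x)) + norm (v - (z - x)))"
    using \<epsilon> by (intro mult_left_mono) auto
  ultimately show ?thesis by linarith
qed

section \<open>Nets decreasing to zero\<close>

text \<open>Smallness of \<open>f (u a)\<close> is all that is needed to shrink the interval around
  \<open>x\<close>, by \<open>norm_diff_center_le_of_order_interval\<close>.\<close>

lemma net_decreases_to_zero_small:
  fixes f :: "'a::banach \<Rightarrow>\<^sub>L real"
  assumes \<epsilon>: "0 < \<epsilon>" and dir: "directed_set A r"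
    and dec: "net_decreases_to_zero (ice_cream_cone f \<epsilon>) A r u" and d: "0 < d"
  shows "\<exists>a\<in>A. blinfun_apply f (u a) < d"
proof -
  let ?K = "ice_cream_cone f \<epsilon>"
  let ?F = "\<lambda>a. blinfun_apply f (u a)"
  define c where "c = (INF a\<in>A. ?F a)"
  have ne: "A \<noteq> {}" using dir by (simp add: directed_set_def)
  have pos: "0 \<le> ?F a" if "a \<in> A" for a
  proof -
    have "\<epsilon> * norm (u a) \<le> ?F a"
      using dec that
      by (simp add: net_decreases_to_zero_def is_infimum_def cone_le_def ice_cream_cone_def)
    then show ?thesis using \<epsilon> by (smt (verit) mult_nonneg_nonneg norm_ge_zero)
  qed
  have bdd: "bdd_below (?F ` A)" using pos by (auto intro!: bdd_belowI2[of A 0])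
  have c_le: "c \<le> ?F a" if "a \<in> A" for a
    unfolding c_def using bdd that by (rule cINF_lower)
  have mono: "u a - u b \<in> ?K" if "a \<in> A" "b \<in> A" "r a b" for a b
    using dec that by (simp add: net_decreases_to_zero_def cone_le_def)
  \<comment> \<open>The bound does not depend on \<open>b\<close>: it controls the whole tail of the
    net beyond \<open>a\<close>.\<close>
  have close: "\<epsilon> * norm (u a - u b) \<le> ?F a - c" if "a \<in> A" "b \<in> A" "r a b" for a b
    using mono[OF that] c_le[OF that(2)] by (simp add: ice_cream_cone_def blinfun.diff_right)
  \<comment> \<open>A sequence of indices nearly attaining the infimum gives access to sequential
    completeness. It need not be increasing for \<open>r\<close>.\<close>
  have "\<exists>a\<in>A. ?F a < c + \<epsilon> * inverse (real (Suc n))" for n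
    using cINF_less_iff[OF ne bdd, of "c + \<epsilon> * inverse (real (Suc n))"] \<epsilon>
    by (simp add: c_def)
  then obtain s where s: "\<And>n. s n \<in> A" "\<And>n. ?F (s n) < c + \<epsilon> * inverse (real (Suc n))"
    by metis
  have near: "norm (u (s n) - u b) < inverse (real (Suc n))" if "b \<in> A" "r (s n) b" for n b
  proof -
    have "\<epsilon> * norm (u (s n) - u b) < \<epsilon> * inverse (real (Suc n))"
      using close[OF s(1) that] s(2)[of n] by linarith
    then show ?thesis using \<epsilon> by simp
  qed
  have "Cauchy (\<lambda>n. u (s n))"
  proof (rule metric_CauchyI)
    fix h :: real assume "0 < h"
    then obtain N where N: "inverse (real (Suc N)) < h / 2"
      using reals_Archimedean[of "h / 2"] by auto
    have inv: "inverse (real (Suc k)) < h / 2" if "N \<le> k" for k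
      using that by (intro le_less_trans[OF le_imp_inverse_le N]) simp_all
    show "\<exists>M. \<forall>m\<ge>M. \<forall>n\<ge>M. dist (u (s m)) (u (s n)) < h"
    proof (intro exI[of _ N] allI impI)
      fix m n assume mn: "N \<le> m" "N \<le> n"
      \<comment> \<open>\<open>s m\<close> and \<open>s n\<close> may be incomparable, so they are
        compared through a common upper bound.\<close>
      obtain b where "b \<in> A" "r (s m) b" "r (s n) b"
        using dir s(1) unfolding directed_set_def by blast
      then have "dist (u (s m)) (u b) < h / 2" "dist (u (s n)) (u b) < h / 2"
        using near[of b m] near[of b n] inv mn by (fastforce simp: dist_norm)+
      then show "dist (u (s m)) (u (s n)) < h" by (rule dist_triangle_half_l)
    qed
  qed
  then obtain l where l: "(\<lambda>n. u (s n)) \<longlonglongrightarrow> l"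
    using Cauchy_convergent_iff convergent_def by blast
  have "cone_le ?K l (u a)" if a: "a \<in> A" for a
  proof -
    \<comment> \<open>The indices \<open>g n\<close> lie beyond both \<open>s n\<close> and
      \<open>a\<close>: the first makes \<open>u (g n)\<close> converge to \<open>l\<close> too, the
      second puts \<open>u a - u (g n)\<close> in the closed cone.\<close>
    have "\<exists>b\<in>A. r a b \<and> r (s n) b" for n
      using dir s(1) a unfolding directed_set_def by blast
    then obtain g where g: "\<And>n. g n \<in> A" "\<And>n. r a (g n)" "\<And>n. r (s n) (g n)" by metis
    have "(\<lambda>n. u (s n) - u (g n)) \<longlonglongrightarrow> 0"
      using near[OF g(1,3)]
      by (intro tendsto_0_le[OF LIMSEQ_inverse_real_of_nat, where K = 1])
        (auto intro!: always_eventually less_imp_le)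
    from tendsto_diff[OF l this] have "(\<lambda>n. u (g n)) \<longlonglongrightarrow> l" by simp
    then have "(\<lambda>n. u a - u (g n)) \<longlonglongrightarrow> u a - l" by (intro tendsto_intros)
    then have "u a - l \<in> ?K"
      by (rule closed_sequentially[OF closed_ice_cream_cone mono[OF a g(1,2)]])
    then show ?thesis by (simp add: cone_le_def)
  qed
  then have "cone_le ?K l 0"
    using dec by (simp add: net_decreases_to_zero_def is_infimum_def)
  \<comment> \<open>This is membership of \<open>- l\<close> in the cone; it forces f l \<le> 0,
    while \<open>f l\<close> is also a limit of nonnegative values.\<close>
  then have "\<epsilon> * norm l + blinfun_apply f l \<le> 0"
    by (simp add: cone_le_def ice_cream_cone_def blinfun.minus_right)
  moreover have lim: "(\<lambda>n. ?F (s n)) \<longlonglongrightarrow> blinfun_apply f l"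
    using l by (intro tendsto_intros)
  then have "0 \<le> blinfun_apply f l"
    using pos s(1) by (intro LIMSEQ_le_const) auto
  ultimately have "blinfun_apply f l = 0"
    using \<epsilon> by (smt (verit) mult_nonneg_nonneg norm_ge_zero)
  then have "\<forall>\<^sub>F n in sequentially. ?F (s n) < d"
    using order_tendstoD(2)[OF lim, of d] d by simp
  then show ?thesis using s(1) eventually_happens'[OF sequentially_bot] by blast
qed

text \<open>A lower bound \<open>l\<close> satisfies e/(n+1) - l \<in> K for all n, and closedness
  of the cone K yields - l \<in> K in the limit.\<close>

lemma net_decreases_to_zero_inverse:
  assumes e: "e \<in> ice_cream_cone f \<epsilon>" and \<epsilon>: "0 \<le> \<epsilon>"
  shows "net_decreases_to_zero (ice_cream_cone f \<epsilon>) UNIV (\<le>) (\<lambda>n. inverse (real (Suc n)) *\<^sub>R e)"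
  unfolding net_decreases_to_zero_def is_infimum_def
proof (intro conjI ballI allI impI)
  fix m n :: nat assume "m \<le> n"
  then have "0 \<le> inverse (real (Suc m)) - inverse (real (Suc n))"
    using le_imp_inverse_le[of "real (Suc m)" "real (Suc n)"] by simp
  from ice_cream_cone_scaleR[OF this e]
  show "cone_le (ice_cream_cone f \<epsilon>) (inverse (real (Suc n)) *\<^sub>R e) (inverse (real (Suc m)) *\<^sub>R e)"
    by (simp add: cone_le_def scaleR_diff_left)
next
  fix s assume "s \<in> range (\<lambda>n. inverse (real (Suc n)) *\<^sub>R e)"
  then show "cone_le (ice_cream_cone f \<epsilon>) 0 s"
    using ice_cream_cone_scaleR[OF _ e] by (auto simp: cone_le_def)
next
  fix l assume "\<forall>s\<in>range (\<lambda>n. inverse (real (Suc n)) *\<^sub>R e). cone_le (ice_cream_cone f \<epsilon>) l s"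
  then have "inverse (real (Suc n)) *\<^sub>R e - l \<in> ice_cream_cone f \<epsilon>" for n
    by (auto simp: cone_le_def)
  moreover have "(\<lambda>n. inverse (real (Suc n)) *\<^sub>R e - l) \<longlonglongrightarrow> 0 *\<^sub>R e - l"
    by (intro tendsto_intros LIMSEQ_inverse_real_of_nat)
  ultimately show "cone_le (ice_cream_cone f \<epsilon>) l 0"
    using closed_sequentially[OF closed_ice_cream_cone, of "\<lambda>n. inverse (real (Suc n)) *\<^sub>R e - l"]
    by (simp add: cone_le_def)
qed

section \<open>The order topology\<close>

lemma order_open_ice_cream_cone_iff_open:
  fixes f :: "'a::banach \<Rightarrow>\<^sub>L real"
  assumes f: "norm f = 1" and \<epsilon>: "0 < \<epsilon>" "\<epsilon> < 1"
  shows "order_open (ice_cream_cone f \<epsilon>) U \<longleftrightarrow> open U"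
proof
  let ?K = "ice_cream_cone f \<epsilon>"
  assume U: "order_open ?K U"
  obtain e where e: "\<epsilon> * norm e < blinfun_apply f e" using exists_blinfun_gt[of \<epsilon> f] f \<epsilon> by auto
  then have "e \<in> ?K" by (simp add: ice_cream_cone_def)
  show "open U"
    unfolding open_contains_cball
  proof
    fix x assume "x \<in> U"
    then have "net_catching ?K U x" using U by (simp add: order_open_def)
    moreover have "\<exists>c. a \<le> c \<and> b \<le> c" for a b :: nat
      by (intro exI[of _ "max a b"]) simp
    then have "directed_set UNIV ((\<le>) :: nat \<Rightarrow> _)"
      by (simp add: directed_set_def reflp_on_def transp_on_def)
    \<comment> \<open>The net is indexed by naturals, whereas \<open>net_catching\<close> quantifies
      over index sets inside the space; \<open>net_catching_any_index\<close> bridges this.\<close>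
    ultimately have "\<exists>n\<in>UNIV. order_interval ?K (x - inverse (real (Suc n)) *\<^sub>R e)
        (x + inverse (real (Suc n)) *\<^sub>R e) \<subseteq> U"
      using net_decreases_to_zero_inverse[OF \<open>e \<in> ?K\<close>] \<epsilon>
      by (intro net_catching_any_index[where r = "(\<le>)"] ice_cream_cone_zero ice_cream_cone_add)
        simp_all
    then obtain n where n: "order_interval ?K (x - inverse (real (Suc n)) *\<^sub>R e)
        (x + inverse (real (Suc n)) *\<^sub>R e) \<subseteq> U"
      by blast
    define t where "t = inverse (real (Suc n))"
    have t: "0 < t" by (simp add: t_def)
    have "cball x (t * (blinfun_apply f e - \<epsilon> * norm e) / 2) \<subseteq> U"
      using n ice_cream_interval_contains_ball[OF f \<epsilon>, of t _ x e] t
      unfolding t_def[symmetric] by (force simp: dist_norm norm_minus_commute)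
    then show "\<exists>r>0. cball x r \<subseteq> U" using t e by (meson diff_gt_0_iff_gt half_gt_zero mult_pos_pos)
  qed
next
  let ?K = "ice_cream_cone f \<epsilon>"
  assume U: "open U"
  show "order_open ?K U"
    unfolding order_open_def net_catching_def
  proof (intro ballI allI impI, elim conjE)
    fix x r u and A :: "'a set"
    assume x: "x \<in> U" and net: "directed_set A r" "net_decreases_to_zero ?K A r u"
    obtain d where d: "0 < d" "ball x d \<subseteq> U" using U x by (meson open_contains_ball)
    obtain a where a: "a \<in> A" "blinfun_apply f (u a) < \<epsilon> * d"
      using net_decreases_to_zero_small[OF \<epsilon>(1) net, of "\<epsilon> * d"] \<epsilon> d(1) by auto
    have "order_interval ?K (x - u a) (x + u a) \<subseteq> ball x d"
    proof
      fix z assume "z \<in> order_interval ?K (x - u a) (x + u a)"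
      then have "\<epsilon> * norm (z - x) < \<epsilon> * d"
        using norm_diff_center_le_of_order_interval[OF \<epsilon>(1)] a(2) by (meson le_less_trans)
      then show "z \<in> ball x d" using \<epsilon>(1) by (simp add: dist_norm norm_minus_commute)
    qed
    then show "\<exists>a\<in>A. order_interval ?K (x - u a) (x + u a) \<subseteq> U" using a(1) d(2) by blast
  qed
qed

section \<open>The order bound topology\<close>

lemma vector_topology_euclidean: "vector_topology (euclidean :: 'a::real_normed_vector topology)"
  unfolding vector_topology_def
  by (auto simp: case_prod_beta' intro!: continuous_intros)

lemma circled_cball: "circled (cball (0::'a::real_normed_vector) d)"
  unfolding circled_def
proof (clarsimp)
  fix c :: real and x :: 'a assume "- 1 \<le> c" "c \<le> 1" "norm x \<le> d"
  then show "\<bar>c\<bar> * norm x \<le> d"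
    by (smt (verit) mult_left_le_one_le norm_ge_zero)
qed

lemma absorbs_cball:
  fixes N :: "'a::real_normed_vector set"
  assumes "bounded N" "0 < d"
  shows "absorbs (cball 0 d) N"
proof -
  obtain b where b: "0 < b" "\<And>x. x \<in> N \<Longrightarrow> norm x \<le> b"
    using assms(1) bounded_pos by blast
  have "\<bar>c\<bar> * norm x \<le> d" if "\<bar>c\<bar> \<le> d / b" "x \<in> N" for c x
    using mult_mono[OF that(1) b(2)[OF that(2)]] assms(2) b(1) by simp
  then show ?thesis
    unfolding absorbs_def using assms(2) b(1)
    by (intro exI[of _ "d / b"]) (auto simp: abs_le_iff)
qed

lemma cball_in_order_bound_base_ice_cream_cone:
  assumes "0 < \<epsilon>" "0 < d"
  shows "cball 0 d \<in> order_bound_base (ice_cream_cone f \<epsilon>)"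
proof -
  have "bounded (order_interval (ice_cream_cone f \<epsilon>) x y)" for x y
  proof -
    have "order_interval (ice_cream_cone f \<epsilon>) x y \<subseteq> cball x (blinfun_apply f (y - x) / \<epsilon>)"
      using norm_diff_le_of_order_interval[OF assms(1)] assms(1)
      by (auto simp: dist_norm norm_minus_commute pos_le_divide_eq mult.commute)
    then show ?thesis using bounded_cball bounded_subset by blast
  qed
  then show ?thesis
    using assms(2) by (simp add: order_bound_base_def circled_cball absorbs_cball)
qed

text \<open>\<open>V\<close> absorbs the interval [-e, e], which contains a ball around 0; so
  \<open>V\<close> contains a rescaled ball.\<close>

lemma order_bound_base_contains_ball:
  fixes f :: "'a::real_normed_vector \<Rightarrow>\<^sub>L real"
  assumes f: "norm f = 1" and \<epsilon>: "0 < \<epsilon>" "\<epsilon> < 1"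
    and V: "V \<in> order_bound_base (ice_cream_cone f \<epsilon>)"
  obtains d where "0 < d" "ball 0 d \<subseteq> V"
proof -
  obtain e where e: "\<epsilon> * norm e < blinfun_apply f e" using exists_blinfun_gt[of \<epsilon> f] f \<epsilon> by auto
  \<comment> \<open>The endpoints are written to match
    \<open>ice_cream_interval_contains_ball\<close> with centre 0 and \<open>t = 1\<close>.\<close>
  have "absorbs V (order_interval (ice_cream_cone f \<epsilon>) (0 - 1 *\<^sub>R e) (0 + 1 *\<^sub>R e))"
    using V unfolding order_bound_base_def by blast
  then obtain \<mu> where \<mu>: "0 < \<mu>" "\<forall>c\<in>{-\<mu>..\<mu>}.
      (*\<^sub>R) c ` order_interval (ice_cream_cone f \<epsilon>) (0 - 1 *\<^sub>R e) (0 + 1 *\<^sub>R e) \<subseteq> V"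
    unfolding absorbs_def by blast
  then have absorb: "\<mu> *\<^sub>R z \<in> V"
    if "z \<in> order_interval (ice_cream_cone f \<epsilon>) (0 - 1 *\<^sub>R e) (0 + 1 *\<^sub>R e)" for z
    using that by (auto dest!: bspec[of _ _ \<mu>])
  \<comment> \<open>Half the gap at \<open>e\<close> is the radius of a ball inside [-e, e]; \<mu>
    is the absorption factor.\<close>
  define d where "d = \<mu> * ((blinfun_apply f e - \<epsilon> * norm e) / 2)"
  have "z \<in> V" if "norm z < d" for z
  proof -
    have "2 * norm ((1 / \<mu>) *\<^sub>R z - 0) \<le> 1 * (blinfun_apply f e - \<epsilon> * norm e)"
      using that \<mu>(1) by (simp add: d_def field_simps)
    then have "\<mu> *\<^sub>R (1 / \<mu>) *\<^sub>R z \<in> V"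
      by (intro absorb ice_cream_interval_contains_ball[OF f \<epsilon>]) simp_all
    then show ?thesis using \<mu>(1) by simp
  qed
  moreover have "0 < d" using \<mu>(1) e by (simp add: d_def)
  ultimately show ?thesis by (intro that[of d] subsetI) simp_all
qed

lemma order_bound_topology_ice_cream_cone:
  fixes f :: "'a::real_normed_vector \<Rightarrow>\<^sub>L real"
  assumes f: "norm f = 1" and \<epsilon>: "0 < \<epsilon>" "\<epsilon> < 1"
  shows "order_bound_topology (ice_cream_cone f \<epsilon>) = euclidean"
proof (rule order_bound_topology_eqI[OF vector_topology_euclidean])
  let ?B = "order_bound_base (ice_cream_cone f \<epsilon>)"
  show "is_neighbourhood_base euclidean 0 ?B"
    unfolding is_neighbourhood_base_def neighbourhood_base_at_def
  proof (intro conjI ballI allI impI)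
    fix V assume "V \<in> ?B"
    then obtain d where "0 < d" "ball 0 d \<subseteq> V"
      by (rule order_bound_base_contains_ball[OF f \<epsilon>])
    then show "\<exists>U. openin euclidean U \<and> 0 \<in> U \<and> U \<subseteq> V"
      by (intro exI[of _ "ball 0 d"]) auto
  next
    fix S :: "'a set" assume "openin euclidean S \<and> 0 \<in> S"
    then obtain d where d: "0 < d" "cball 0 d \<subseteq> S"
      using open_contains_cball by (metis open_openin)
    then show "\<exists>U V. openin euclidean U \<and> V \<in> ?B \<and> 0 \<in> U \<and> U \<subseteq> V \<and> V \<subseteq> S"
      using cball_in_order_bound_base_ice_cream_cone[OF \<epsilon>(1) d(1)]
      by (intro exI[of _ "ball 0 d"] exI[of _ "cball 0 d"]) auto
  qed
qed

theorem proposition9p1: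
  fixes f :: "'a::banach \<Rightarrow>\<^sub>L real" and \<epsilon> :: real
  assumes "reflexive_space TYPE('a)"
    and "norm f = 1"
    and "0 < \<epsilon>" and "\<epsilon> < 1"
  shows "order_topology (ice_cream_cone f \<epsilon>) = (euclidean :: 'a topology) \<and>
         order_bound_topology (ice_cream_cone f \<epsilon>) = (euclidean :: 'a topology)"
proof
  show "order_topology (ice_cream_cone f \<epsilon>) = (euclidean :: 'a topology)"
    using assms(2-4)
    by (simp add: topology_eq openin_order_topology_ice_cream_cone
        order_open_ice_cream_cone_iff_open)
  show "order_bound_topology (ice_cream_cone f \<epsilon>) = (euclidean :: 'a topology)"
    using assms(2-4) by (rule order_bound_topology_ice_cream_cone)
qed

end
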